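(* Fix students $I$, colleges $C$, capacities and scores, and fix an arbitrary probability distribution $\mathbb{P}$ over preference profiles. Suppose that students follow straightforward strategies in the time-constrained dynamic mechanism (TCDM). Then for every $T\ge1$: 1. For every student $i$, $p_{i,1}^{TCDM(T)}\ge p_{i,1}^{TCDM(T+1)}$. 2. The expected number of students assigned to a non-first-choice college weakly increases from $T$ to $T+1$: $$\sum_{i\in I}\sum_{l=2}^{|C|}p_{i,l}^{TCDM(T)}\le\sum_{i\in I}\sum_{l=2}^{|C|}p_{i,l}^{TCDM(T+1)}.$$
   Context: Problem. $I$ is a finite set of students and $C$ a finite set of colleges. A preference profile is $\succ=(\succ_i)_{i\in I}$, where each $\succ_i$ is a strict linear order over $C\cup\{\emptyset\}$ and $\emptyset$ is the outside option (being unassigned). Each college $c$ has capacity $q_c\in\mathbb{N}_+$. Each student has a score $s_i>0$, scores are distinct, and every college uses the common strict priority order $i\triangleright j\iff s_i>s_j$. A matching is a map $\mu:I\to C\cup\{\emptyset\}$ with $|\mu^{-1}(c)|\le q_c$ for all $c$. The cutoff of $c$ at $\mu$ is $f_c(\mu)=\min\{s_i:i\in\mu^{-1}(c)\}$ if $|\mu^{-1}(c)|=q_c$, and $f_c(\mu)=0$ otherwise. TCDM with $T$ rounds, with outcome $\mu^{TCDM(T)}(\succ)=\mu^T$. In each round $t=1,\dots,T$ every student chooses one element of $C\cup\{\emptyset\}$ (replacing any earlier application). Given the current application profile, each college tentatively holds its highest-priority current applicants up to capacity and rejects the others; this defines the tentative matching $\mu^t$ (students who are rejected or chose $\emptyset$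 are unassigned). Straightforward strategy. In round 1 student $i$ applies to her $\succ_i$-best element of $C\cup\{\emptyset\}$. In round $t>1$: if $\mu^{t-1}(i)\in C$, she applies again to $\mu^{t-1}(i)$; if $\mu^{t-1}(i)=\emptyset$, she chooses her $\succ_i$-best element of $\{c\in C: s_i\ge f_c(\mu^{t-1})\}\cup\{\emptyset\}$. Probabilities. Let $c_i^l(\succ_i)$ be student $i$'s $l$-th-ranked college under $\succ_i$. Then $p_{i,l}^{TCDM(T)}=\mathbb{P}(\mu^{TCDM(T)}(\succ)(i)=c_i^l(\succ_i))$. *)

theory Defs
  imports "HOL-Probability.Probability_Mass_Function"
begin

text \<open>
  An element of \<open>C \<union> {\<emptyset>}\<close> is a value of type \<open>'c option\<close>: \<open>None\<close> is the outside option.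
  A preference is a strict linear order given as a relation; \<open>(a, b) \<in> r\<close> means that
  \<open>a\<close> is strictly preferred to \<open>b\<close>.
\<close>

type_synonym 'c preference = "('c option \<times> 'c option) set"
type_synonym ('i, 'c) profile = "'i \<Rightarrow> 'c preference"
type_synonym ('i, 'c) matching = "'i \<Rightarrow> 'c option"

definition alternatives :: "'c set \<Rightarrow> 'c option set" where
  "alternatives C = insert None (Some ` C)"

definition preferences :: "'c set \<Rightarrow> 'c preference set" where
  "preferences C =
     {r. r \<subseteq> alternatives C \<times> alternatives C \<and> strict_linear_order_on (alternatives C) r}"

definition preference_profiles :: "'i set \<Rightarrow> 'c set \<Rightarrow> ('i, 'c) profile set" where
  "preference_profiles I C = (\<Pi>\<^sub>E i\<in>I. preferences C)"

definition best :: "'c preference \<Rightarrow> 'c option set \<Rightarrow> 'c option" where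
  "best r S = (THE x. x \<in> S \<and> (\<forall>y\<in>S. y \<noteq> x \<longrightarrow> (x, y) \<in> r))"

text \<open>
  The \<open>l\<close>-th ranked college (counting from 1). Only colleges are counted: the position of the
  outside option in the order does not affect the rank of a college.
\<close>

definition ranked_college :: "'c set \<Rightarrow> 'c preference \<Rightarrow> nat \<Rightarrow> 'c" where
  "ranked_college C r l =
     (THE c. c \<in> C \<and> card {d \<in> C. (Some d, Some c) \<in> r} + 1 = l)"

definition assigned :: "'i set \<Rightarrow> ('i, 'c) matching \<Rightarrow> 'c \<Rightarrow> 'i set" where
  "assigned I \<mu> c = {i \<in> I. \<mu> i = Some c}"

definition cutoff ::
  "'i set \<Rightarrow> ('c \<Rightarrow> nat) \<Rightarrow> ('i \<Rightarrow> real) \<Rightarrow> ('i, 'c) matching \<Rightarrow> 'c \<Rightarrow> real" where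
  "cutoff I q s \<mu> c =
     (if card (assigned I \<mu> c) = q c then Min (s ` assigned I \<mu> c) else 0)"

text \<open>
  The \<open>n\<close> highest-scoring members of \<open>A\<close>, or all of \<open>A\<close> if it has at most \<open>n\<close> members;
  see \<open>card_highest_scoring\<close> and \<open>highest_scoring_priority\<close> below.
\<close>

definition highest_scoring :: "('i \<Rightarrow> real) \<Rightarrow> nat \<Rightarrow> 'i set \<Rightarrow> 'i set" where
  "highest_scoring s n A = {i \<in> A. card {j \<in> A. s i < s j} < n}"

text \<open>An application profile \<open>a\<close> has the same type as a matching, but ignores capacities.\<close>

definition tentative_matching ::
  "'i set \<Rightarrow> ('c \<Rightarrow> nat) \<Rightarrow> ('i \<Rightarrow> real) \<Rightarrow> ('i \<Rightarrow> 'c option) \<Rightarrow> ('i, 'c) matching" where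
  "tentative_matching I q s a = (\<lambda>i. case a i of
       None \<Rightarrow> None
     | Some c \<Rightarrow> if i \<in> highest_scoring s (q c) {j \<in> I. a j = Some c} then Some c else None)"

text \<open>
  A strategy maps the round (counted from 1) and the previous tentative matching to an
  application. The tentative matching before round 1 leaves everybody unassigned; this is
  merely an initial value, as the straightforward strategy ignores it in round 1.
\<close>

type_synonym ('i, 'c) strategy = "nat \<Rightarrow> ('i, 'c) matching \<Rightarrow> 'c option"

primrec tcdm ::
  "'i set \<Rightarrow> ('c \<Rightarrow> nat) \<Rightarrow> ('i \<Rightarrow> real) \<Rightarrow> ('i \<Rightarrow> ('i, 'c) strategy) \<Rightarrow> nat \<Rightarrow> ('i, 'c) matching"
where
  "tcdm I q s \<sigma> 0 = (\<lambda>i. None)"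
| "tcdm I q s \<sigma> (Suc t) = tentative_matching I q s (\<lambda>i. \<sigma> i (Suc t) (tcdm I q s \<sigma> t))"

definition straightforward ::
  "'i set \<Rightarrow> 'c set \<Rightarrow> ('c \<Rightarrow> nat) \<Rightarrow> ('i \<Rightarrow> real) \<Rightarrow> ('i, 'c) profile \<Rightarrow> 'i \<Rightarrow> ('i, 'c) strategy"
where
  "straightforward I C q s R i = (\<lambda>t \<mu>.
     if t = 1 then best (R i) (alternatives C)
     else (case \<mu> i of
         Some c \<Rightarrow> Some c
       | None \<Rightarrow> best (R i) (alternatives {c \<in> C. s i \<ge> cutoff I q s \<mu> c})))"

definition tcdm_outcome ::
  "'i set \<Rightarrow> 'c set \<Rightarrow> ('c \<Rightarrow> nat) \<Rightarrow> ('i \<Rightarrow> real) \<Rightarrow> nat \<Rightarrow> ('i, 'c) profile \<Rightarrow> ('i, 'c) matching"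
where
  "tcdm_outcome I C q s T R = tcdm I q s (straightforward I C q s R) T"

definition assignment_prob ::
  "'i set \<Rightarrow> 'c set \<Rightarrow> ('c \<Rightarrow> nat) \<Rightarrow> ('i \<Rightarrow> real) \<Rightarrow> ('i, 'c) profile pmf \<Rightarrow> nat \<Rightarrow> 'i \<Rightarrow> nat \<Rightarrow> real"
where
  "assignment_prob I C q s P T i l =
     measure_pmf.prob P {R. tcdm_outcome I C q s T R i = Some (ranked_college C (R i) l)}"

lemma card_highest_scoring:
  assumes fin: "finite A" and inj: "inj_on s A"
  shows "card (highest_scoring s n A) = min n (card A)"
proof -
  define g where "g i = card {j \<in> A. s i < s j}" for i
  have less: "g i < g j" if "i \<in> A" "j \<in> A" "s j < s i" for i j
    unfolding g_def using that fin by (intro psubset_card_mono) auto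
  have g_inj: "inj_on g A"
    using less inj by (metis (no_types, lifting) inj_on_def less_irrefl linorder_neqE_linordered_idom)
  have "g ` A \<subseteq> {..<card A}"
    unfolding g_def using fin by (auto intro!: psubset_card_mono)
  moreover have "card (g ` A) = card {..<card A}"
    using g_inj by (simp add: card_image)
  ultimately have img: "g ` A = {..<card A}"
    by (simp add: card_subset_eq)
  have "g ` highest_scoring s n A = {..<min n (card A)}"
  proof -
    have "g ` highest_scoring s n A = g ` A \<inter> {..<n}"
      unfolding highest_scoring_def g_def by auto
    then show ?thesis using img by auto
  qed
  moreover have "inj_on g (highest_scoring s n A)"
    using g_inj by (rule inj_on_subset) (auto simp: highest_scoring_def)
  ultimately show ?thesis
    by (metis card_image card_lessThan)
qed

lemma highest_scoring_priority:
  assumes "finite A" "inj_on s A" "i \<in> highest_scoring s n A" "j \<in> A - highest_scoring s n A"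
  shows "s j < s i"
proof (rule ccontr)
  assume "\<not> s j < s i"
  then have "card {k \<in> A. s j < s k} \<le> card {k \<in> A. s i < s k}"
    using assms(1) by (intro card_mono) auto
  then show False using assms(3,4) by (auto simp: highest_scoring_def)
qed

end

theory Submission
  imports Defs
begin

text \<open>
  Fix a profile. Held students apply again, so the applicants of a college include the students it
  held before; hence both the number of students it holds and its cutoff weakly increase over time.
  A student who is not at her favourite college, although it was her first application, has been
  rejected there and stays below its cutoff forever. So the set of students at their first choice
  shrinks while the number of assigned students grows, and the number of students at a non-first
  choice, being the difference, grows as well. Taking expectations gives both claims.
\<close>

section \<open>Sums of indicators and their expectations\<close>

lemma sum_of_bool_eq_option:
  assumes "finite A"
  shows "(\<Sum>a\<in>A. of_bool (x = Some a) :: 'b::semiring_1) = of_bool (x \<in> Some ` A)"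
proof (cases x)
  case (Some y)
  have "(\<Sum>a\<in>A. of_bool (x = Some a) :: 'b) = (\<Sum>a\<in>A. if y = a then 1 else 0)"
    using Some by (intro sum.cong) auto
  then show ?thesis
    using Some assms by (simp add: inj_image_mem_iff)
qed auto

lemma sum_prob_eq_expectation:
  assumes "finite A"
  shows "(\<Sum>x\<in>A. measure_pmf.prob P {y. Q x y})
           = measure_pmf.expectation P (\<lambda>y. \<Sum>x\<in>A. of_bool (Q x y))"
proof -
  have ind: "(\<lambda>y. of_bool (Q x y) :: real) = indicator {y. Q x y}" for x
    by (auto simp: indicator_def)
  have "integrable (measure_pmf P) (\<lambda>y. of_bool (Q x y) :: real)" for x
    unfolding ind by (simp add: integrable_real_indicator measure_pmf.emeasure_finite less_top[symmetric])
  then have "measure_pmf.expectation P (\<lambda>y. \<Sum>x\<in>A. of_bool (Q x y))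
          = (\<Sum>x\<in>A. measure_pmf.expectation P (\<lambda>y. of_bool (Q x y) :: real))"
    by (rule Bochner_Integration.integral_sum)
  then show ?thesis
    by (simp add: ind)
qed

text \<open>By linearity, each sum of probabilities is the expected number of events that occur, so
  comparing these numbers profile by profile on the support of \<open>P\<close> suffices. Finiteness
  of the index sets bounds the numbers and makes them integrable.\<close>

lemma sum_prob_mono:
  assumes "finite A" "finite B"
    and le: "\<And>y. y \<in> set_pmf P \<Longrightarrow>
      (\<Sum>x\<in>A. of_bool (Q x y) :: real) \<le> (\<Sum>x\<in>B. of_bool (Q' x y))"
  shows "(\<Sum>x\<in>A. measure_pmf.prob P {y. Q x y}) \<le> (\<Sum>x\<in>B. measure_pmf.prob P {y. Q' x y})"
proof -
  have int: "integrable (measure_pmf P) (\<lambda>y. \<Sum>x\<in>D. of_bool (W x y) :: real)"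
    if "finite D" for D :: "'d set" and W
  proof (rule measure_pmf.integrable_const_bound[where B = "real (card D)"])
    have "(\<Sum>x\<in>D. of_bool (W x y) :: real) \<le> card D" for y
      using sum_mono[of D "\<lambda>x. of_bool (W x y) :: real" "\<lambda>_. 1"] by simp
    then show "AE y in measure_pmf P. norm (\<Sum>x\<in>D. of_bool (W x y) :: real) \<le> card D"
      by (simp add: sum_nonneg)
  qed simp
  have "measure_pmf.expectation P (\<lambda>y. \<Sum>x\<in>A. of_bool (Q x y) :: real)
      \<le> measure_pmf.expectation P (\<lambda>y. \<Sum>x\<in>B. of_bool (Q' x y))"
    using assms(1,2) le by (intro integral_mono_AE int) (auto simp: AE_measure_pmf_iff)
  then show ?thesis
    using assms(1,2) by (simp add: sum_prob_eq_expectation)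
qed

section \<open>Best elements of finite menus\<close>

lemma strict_linear_order_best_exists:
  assumes "strict_linear_order_on A r" "finite S" "S \<noteq> {}" "S \<subseteq> A"
  shows "\<exists>x\<in>S. \<forall>y\<in>S. y \<noteq> x \<longrightarrow> (x, y) \<in> r"
  using assms(2-4)
proof (induction rule: finite_ne_induct)
  case (insert a F)
  then obtain x where x: "x \<in> F" "\<forall>y\<in>F. y \<noteq> x \<longrightarrow> (x, y) \<in> r" by auto
  have tr: "trans r" and "total_on A r"
    using assms(1) by (auto simp: strict_linear_order_on_def)
  then have "(x, a) \<in> r \<or> (a, x) \<in> r"
    using insert.hyps insert.prems x(1) by (metis insert_subset subsetD total_on_def)
  then show ?case
  proof
    assume "(a, x) \<in> r"
    then have "\<forall>y\<in>insert a F. y \<noteq> a \<longrightarrow> (a, y) \<in> r"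
      using x tr by (metis insert_iff transD)
    then show ?thesis by blast
  qed (use x in auto)
qed auto

lemma best_eqI:
  assumes "strict_linear_order_on A r" "x \<in> S" "\<And>y. y \<in> S \<Longrightarrow> y \<noteq> x \<Longrightarrow> (x, y) \<in> r"
  shows "best r S = x"
proof -
  have "trans r" "irrefl r"
    using assms(1) by (auto simp: strict_linear_order_on_def)
  then have "(y, x) \<notin> r" if "(x, y) \<in> r" for y
    using that by (meson irrefl_def transD)
  then show ?thesis
    unfolding best_def using assms(2,3) by (intro the_equality) metis+
qed

lemma
  assumes "strict_linear_order_on A r" "finite S" "S \<noteq> {}" "S \<subseteq> A"
  shows best_in: "best r S \<in> S"
    and best_preferred: "y \<in> S \<Longrightarrow> y \<noteq> best r S \<Longrightarrow> (best r S, y) \<in> r"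
proof -
  obtain x where x: "x \<in> S" "\<forall>y\<in>S. y \<noteq> x \<longrightarrow> (x, y) \<in> r"
    using strict_linear_order_best_exists[OF assms] by blast
  then have "best r S = x"
    using best_eqI[OF assms(1)] by blast
  then show "best r S \<in> S" "y \<in> S \<Longrightarrow> y \<noteq> best r S \<Longrightarrow> (best r S, y) \<in> r"
    using x by auto
qed

lemma preferencesD:
  assumes "r \<in> preferences C"
  shows "strict_linear_order_on (alternatives C) r"
  using assms by (simp add: preferences_def)

section \<open>Ranks of colleges under one preference\<close>

context
  fixes C :: "'c set" and r :: "'c preference"
  assumes fin: "finite C" and pref: "r \<in> preferences C"
begin

text \<open>The rank of a college counted from 0, ignoring the outside option. It makes explicit the
  inverse of \<open>ranked_college\<close>, which is given only by a definite description.\<close>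

definition better_colleges :: "'c \<Rightarrow> nat" where
  "better_colleges c = card {d \<in> C. (Some d, Some c) \<in> r}"

lemma preference_order:
  shows "trans r" "irrefl r" "total_on (alternatives C) r"
  using preferencesD[OF pref] by (auto simp: strict_linear_order_on_def)

lemma better_colleges_less:
  assumes "c \<in> C" "(Some c, Some d) \<in> r"
  shows "better_colleges c < better_colleges d"
  unfolding better_colleges_def
proof (rule psubset_card_mono)
  have "(Some c, Some c) \<notin> r"
    using preference_order(2) by (simp add: irrefl_def)
  then show "{e \<in> C. (Some e, Some c) \<in> r} \<subset> {e \<in> C. (Some e, Some d) \<in> r}"
    using assms preference_order(1) by (auto dest: transD)
qed (use fin in simp)

text \<open>Totality and \<open>better_colleges_less\<close> give injectivity. No college is better
  than itself, so every value is below \<open>card C\<close>; an injection into a finite set of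
  equal size is onto.\<close>

lemma bij_betw_better_colleges: "bij_betw better_colleges C {..<card C}"
proof -
  have inj: "inj_on better_colleges C"
  proof (rule inj_onI)
    fix c d assume *: "c \<in> C" "d \<in> C" "better_colleges c = better_colleges d"
    show "c = d"
    proof (rule ccontr)
      assume "c \<noteq> d"
      then have "(Some c, Some d) \<in> r \<or> (Some d, Some c) \<in> r"
        using preference_order(3) * by (auto simp: total_on_def alternatives_def)
      then show False
        using better_colleges_less * by fastforce
    qed
  qed
  have "(Some c, Some c) \<notin> r" for c
    using preference_order(2) by (simp add: irrefl_def)
  then have "better_colleges ` C \<subseteq> {..<card C}"
    unfolding better_colleges_def using fin by (auto intro!: psubset_card_mono)
  then have "better_colleges ` C = {..<card C}"
    using inj by (simp add: card_image card_subset_eq)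
  with inj show ?thesis by (simp add: bij_betw_def)
qed

lemma ranked_college_better_colleges:
  assumes "c \<in> C"
  shows "ranked_college C r (Suc (better_colleges c)) = c"
proof -
  have inj: "inj_on better_colleges C"
    using bij_betw_better_colleges by (rule bij_betw_imp_inj_on)
  show ?thesis
    unfolding ranked_college_def better_colleges_def[symmetric]
    using assms by (intro the_equality) (auto dest: inj_onD[OF inj])
qed

lemma bij_betw_ranked_college: "bij_betw (ranked_college C r) {1..card C} C"
\<comment> \<open>The successor shifts from ranks counted from 0 to those of
  \<open>ranked_college\<close>, which start at 1.\<close>
proof (rule bij_betw_byWitness[where f' = "\<lambda>c. Suc (better_colleges c)"])
  have img: "better_colleges ` C = {..<card C}"
    using bij_betw_better_colleges by (simp add: bij_betw_def)
  have ex: "\<exists>c\<in>C. l = Suc (better_colleges c)" if "l \<in> {1..card C}" for l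
  proof -
    have "l - 1 \<in> better_colleges ` C" using that img by auto
    then obtain c where "c \<in> C" "l - 1 = better_colleges c" by auto
    then show ?thesis using that by (intro bexI[of _ c]) auto
  qed
  show "\<forall>l\<in>{1..card C}. Suc (better_colleges (ranked_college C r l)) = l"
    using ex ranked_college_better_colleges by metis
  show "ranked_college C r ` {1..card C} \<subseteq> C"
    using ex ranked_college_better_colleges by fastforce
  show "(\<lambda>c. Suc (better_colleges c)) ` C \<subseteq> {1..card C}"
    using img by (auto simp: image_subset_iff Suc_le_eq)
qed (use ranked_college_better_colleges in auto)

lemma first_ranked_college_in:
  assumes "C \<noteq> {}"
  shows "ranked_college C r 1 \<in> C"
proof -
  have "1 \<in> {1..card C}"
    using assms fin by (simp add: card_gt_0_iff Suc_le_eq)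
  then show ?thesis
    using bij_betw_ranked_college by (metis bij_betwE)
qed

lemma first_ranked_college_preferred:
  assumes "d \<in> C" "d \<noteq> ranked_college C r 1"
  shows "(Some (ranked_college C r 1), Some d) \<in> r"
proof (rule ccontr)
  let ?b = "ranked_college C r 1"
  assume "(Some ?b, Some d) \<notin> r"
  moreover have b: "?b \<in> C" using first_ranked_college_in assms by blast
  ultimately have "(Some d, Some ?b) \<in> r"
    using preference_order(3) assms by (auto simp: total_on_def alternatives_def)
  then have "better_colleges d < better_colleges ?b"
    using better_colleges_less assms by blast
  \<comment> \<open>Some college has none above it. It is the one ranked 1, hence equal to
    \<open>?b\<close>, so no \<open>d\<close> can have a smaller count.\<close>
  moreover obtain c where "c \<in> C" "better_colleges c = 0"
    using bij_betw_better_colleges b fin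
    by (metis bij_betw_def card_gt_0_iff empty_iff imageE lessThan_iff)
  then have "better_colleges ?b = 0"
    using ranked_college_better_colleges[of c] by simp
  ultimately show False by simp
qed

text \<open>Rank 1 only compares colleges, so the top-ranked college may still be worse than the
  outside option. Being chosen from any menu \<open>alternatives D\<close> excludes this, because
  every such menu contains \<open>None\<close>. It follows that a later application to this college
  reveals the same application in round 1.\<close>

lemma best_alternatives_first_ranked_college:
  assumes "D \<subseteq> C" "best r (alternatives D) = Some (ranked_college C r 1)"
  shows "best r (alternatives C) = Some (ranked_college C r 1)"
proof (rule best_eqI[OF preferencesD[OF pref]])
  have D: "finite (alternatives D)" "alternatives D \<noteq> {}" "alternatives D \<subseteq> alternatives C"
    using assms(1) fin by (auto simp: alternatives_def intro: finite_subset)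
  have "Some (ranked_college C r 1) \<in> alternatives D"
    using best_in[OF preferencesD[OF pref] D] assms(2) by simp
  then show "Some (ranked_college C r 1) \<in> alternatives C"
    using D by blast
  fix y assume y: "y \<in> alternatives C" "y \<noteq> Some (ranked_college C r 1)"
  show "(Some (ranked_college C r 1), y) \<in> r"
  proof (cases y)
    case None
    then show ?thesis
      using best_preferred[OF preferencesD[OF pref] D, of None] assms(2)
      by (simp add: alternatives_def)
  next
    case (Some d)
    then show ?thesis
      using y first_ranked_college_preferred by (auto simp: alternatives_def)
  qed
qed

lemma sum_of_bool_ranked_college:
  assumes "x \<in> alternatives C"
  shows "(\<Sum>l=1..card C. of_bool (x = Some (ranked_college C r l)) :: real) = of_bool (x \<noteq> None)"
proof -
  have "(\<Sum>l=1..card C. of_bool (x = Some (ranked_college C r l)) :: real)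
      = (\<Sum>c\<in>C. of_bool (x = Some c))"
    using bij_betw_ranked_college by (rule sum.reindex_bij_betw)
  also have "\<dots> = of_bool (x \<noteq> None)"
    unfolding sum_of_bool_eq_option[OF fin] using assms by (auto simp: alternatives_def)
  finally show ?thesis .
qed

end

section \<open>A single round: rejections, numbers held and cutoffs\<close>

lemma assigned_tentative_matching:
  "assigned I (tentative_matching I q s a) c = highest_scoring s (q c) {j \<in> I. a j = Some c}"
  by (auto simp: assigned_def tentative_matching_def highest_scoring_def split: option.splits if_splits)

lemma tentative_matching_SomeD:
  "tentative_matching I q s a i = Some c \<Longrightarrow> a i = Some c"
  by (auto simp: tentative_matching_def split: option.splits if_splits)

lemma finite_assigned: "finite I \<Longrightarrow> finite (assigned I \<mu> c)"
  by (simp add: assigned_def)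

text \<open>A rejected applicant is outscored by at least \<open>q c\<close> other applicants. Hence
  the college is full, its cutoff is a genuine minimum, and everyone it holds has a higher
  score.\<close>

lemma less_cutoff_if_rejected:
  assumes "finite I" "inj_on s I" "q c > 0" "i \<in> I"
    and "a i = Some c" "tentative_matching I q s a i \<noteq> Some c"
  shows "s i < cutoff I q s (tentative_matching I q s a) c"
proof -
  let ?A = "{j \<in> I. a j = Some c}" and ?H = "assigned I (tentative_matching I q s a) c"
  have fin: "finite ?A" and inj: "inj_on s ?A"
    using assms(1,2) by (auto intro: inj_on_subset)
  have H: "?H = highest_scoring s (q c) ?A"
    by (rule assigned_tentative_matching)
  have i: "i \<in> ?A - ?H"
    using assms(4-6) by (auto simp: assigned_def)
  then have "q c \<le> card {j \<in> ?A. s i < s j}"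
    unfolding H by (auto simp: highest_scoring_def)
  also have "\<dots> \<le> card ?A"
    using fin by (intro card_mono) auto
  finally have card: "card ?H = q c"
    unfolding H card_highest_scoring[OF fin inj] by simp
  moreover have "?H \<noteq> {}"
    using card assms(3) by auto
  moreover have "\<forall>j\<in>?H. s i < s j"
    using highest_scoring_priority[OF fin inj] i unfolding H by blast
  ultimately show ?thesis
    using finite_assigned[OF assms(1), of "tentative_matching I q s a" c] by (simp add: cutoff_def)
qed

text \<open>A college holds the minimum of its capacity and its number of applicants, and its
  applicants include everyone held before.\<close>

lemma card_assigned_mono:
  assumes "finite I" "inj_on s I" "card (assigned I \<mu> c) \<le> q c"
    and "\<And>j. j \<in> assigned I \<mu> c \<Longrightarrow> a j = Some c"
  shows "card (assigned I \<mu> c) \<le> card (assigned I (tentative_matching I q s a) c)"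
proof -
  let ?A = "{j \<in> I. a j = Some c}"
  have fin: "finite ?A" and inj: "inj_on s ?A"
    using assms(1,2) by (auto intro: inj_on_subset)
  have "assigned I \<mu> c \<subseteq> ?A"
    using assms(4) by (auto simp: assigned_def)
  then have "card (assigned I \<mu> c) \<le> card ?A"
    using fin by (intro card_mono)
  then show ?thesis
    using assms(3) unfolding assigned_tentative_matching card_highest_scoring[OF fin inj] by simp
qed

text \<open>A full college stays full, and it replaces held students only by higher-scoring ones. A
  college that was not full had cutoff 0, and scores are positive.\<close>

lemma cutoff_mono:
  assumes "finite I" "inj_on s I" "q c > 0" "\<And>i. i \<in> I \<Longrightarrow> s i > 0"
    and reapply: "\<And>j. j \<in> assigned I \<mu> c \<Longrightarrow> a j = Some c"
  shows "cutoff I q s \<mu> c \<le> cutoff I q s (tentative_matching I q s a) c"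
proof -
  let ?A = "{j \<in> I. a j = Some c}" and ?B = "assigned I \<mu> c"
    and ?H = "assigned I (tentative_matching I q s a) c"
  have fin: "finite ?A" and inj: "inj_on s ?A"
    using assms(1,2) by (auto intro: inj_on_subset)
  have H: "?H = highest_scoring s (q c) ?A"
    by (rule assigned_tentative_matching)
  have BA: "?B \<subseteq> ?A"
    using reapply by (auto simp: assigned_def)
  show ?thesis
  proof (cases "card ?B = q c")
    case True
    then have "q c \<le> card ?A"
      using BA fin by (metis card_mono)
    then have card: "card ?H = q c"
      unfolding H card_highest_scoring[OF fin inj] by simp
    have "Min (s ` ?B) \<le> s h" if h: "h \<in> ?H" for h
    proof (rule ccontr)
      assume *: "\<not> Min (s ` ?B) \<le> s h"
      \<comment> \<open>If \<open>h\<close> scored below the old cutoff, all \<open>q c\<close>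
        students of \<open>?B\<close> would be applicants outscoring \<open>h\<close>, leaving no
        place for \<open>h\<close> among the top \<open>q c\<close>.\<close>
      have "s h < s j" if "j \<in> ?B" for j
        using * that finite_assigned[OF assms(1)] by (metis Min_le finite_imageI imageI linorder_not_le order_less_le_trans)
      then have "card ?B \<le> card {j \<in> ?A. s h < s j}"
        using BA fin by (intro card_mono finite_subset[OF _ fin]) auto
      then show False
        using h True unfolding H by (auto simp: highest_scoring_def)
    qed
    moreover have "?H \<noteq> {}"
      using card assms(3) by auto
    ultimately show ?thesis
      using True card finite_assigned[OF assms(1), of "tentative_matching I q s a" c]
      by (simp add: cutoff_def)
  next
    case False
    have "0 \<le> Min (s ` ?H)" if "card ?H = q c"
    proof -
      have "?H \<noteq> {}" using that assms(3) by auto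
      then show ?thesis
        using finite_assigned[OF assms(1), of "tentative_matching I q s a" c] assms(4)
        by (simp add: Min_ge_iff) (simp add: assigned_def less_imp_le)
    qed
    then show ?thesis
      using False by (simp add: cutoff_def)
  qed
qed

section \<open>The dynamics under straightforward strategies at a fixed profile\<close>

locale straightforward_play =
  fixes I :: "'i set" and C :: "'c set" and q :: "'c \<Rightarrow> nat" and s :: "'i \<Rightarrow> real"
    and R :: "('i, 'c) profile"
  assumes finite_students: "finite I" and finite_colleges: "finite C"
    and capacity_pos: "\<And>c. c \<in> C \<Longrightarrow> q c > 0"
    and score_pos: "\<And>i. i \<in> I \<Longrightarrow> s i > 0" and score_inj: "inj_on s I"
    and profile: "\<And>i. i \<in> I \<Longrightarrow> R i \<in> preferences C"
begin

abbreviation outcome :: "nat \<Rightarrow> ('i, 'c) matching" where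
  "outcome t \<equiv> tcdm_outcome I C q s t R"

text \<open>The index is that of the matching reacted to: \<open>application t\<close> is submitted
  in round \<open>Suc t\<close>, so \<open>application 0\<close> is the initial application.\<close>

definition application :: "nat \<Rightarrow> 'i \<Rightarrow> 'c option" where
  "application t i = straightforward I C q s R i (Suc t) (outcome t)"

lemma outcome_Suc: "outcome (Suc t) = tentative_matching I q s (application t)"
  by (simp add: tcdm_outcome_def application_def[abs_def])

lemma best_in_alternatives:
  assumes "i \<in> I" "D \<subseteq> C"
  shows "best (R i) (alternatives D) \<in> alternatives D"
  using assms finite_colleges
  by (intro best_in[OF preferencesD[OF profile]])
    (auto simp: alternatives_def intro: finite_subset)

lemma outcome_in_alternatives:
  assumes "i \<in> I"
  shows "outcome t i \<in> alternatives C"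
proof (induction t)
  case 0
  then show ?case by (simp add: tcdm_outcome_def alternatives_def)
next
  case (Suc t)
  have "best (R i) (alternatives D) \<in> alternatives C" if "D \<subseteq> C" for D
    using best_in_alternatives[OF assms that] that by (auto simp: alternatives_def)
  then have "application t i \<in> alternatives C"
    using Suc by (auto simp: application_def straightforward_def split: option.splits)
  then show ?case
    unfolding outcome_Suc
    by (auto simp: tentative_matching_def alternatives_def split: option.splits)
qed

lemma held_reapplies:
  assumes "t \<ge> 1" "outcome t i = Some c"
  shows "application t i = Some c"
  using assms by (simp add: application_def straightforward_def)

lemma card_assigned_le_capacity:
  assumes "t \<ge> 1"
  shows "card (assigned I (outcome t) c) \<le> q c"
proof -
  obtain u where "t = Suc u" using assms by (cases t) auto
  moreover have "inj_on s {j \<in> I. a j = Some c}" for a :: "'i \<Rightarrow> 'c option"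
    using score_inj by (auto intro: inj_on_subset)
  ultimately show ?thesis
    using finite_students
    by (simp add: outcome_Suc assigned_tentative_matching card_highest_scoring)
qed

lemma card_assigned_outcome_mono:
  assumes "t \<ge> 1"
  shows "card (assigned I (outcome t) c) \<le> card (assigned I (outcome (Suc t)) c)"
  unfolding outcome_Suc
  using finite_students score_inj card_assigned_le_capacity[OF assms] held_reapplies[OF assms]
  by (intro card_assigned_mono) (auto simp: assigned_def)

lemma cutoff_outcome_mono:
  assumes "t \<ge> 1" "c \<in> C"
  shows "cutoff I q s (outcome t) c \<le> cutoff I q s (outcome (Suc t)) c"
  unfolding outcome_Suc
  using assms finite_students score_inj score_pos capacity_pos held_reapplies[OF assms(1)]
  by (intro cutoff_mono) (auto simp: assigned_def)

text \<open>The favourite \<open>b\<close> is the round 1 application and is reapplied to while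
  held, so a student not at \<open>b\<close> was rejected there in some round. That rejection puts
  her score below the cutoff, and cutoffs never fall afterwards.\<close>

lemma less_cutoff_of_first_choice:
  assumes "i \<in> I" "best (R i) (alternatives C) = Some b" "t \<ge> 1" "outcome t i \<noteq> Some b"
  shows "s i < cutoff I q s (outcome t) b"
proof -
  have b: "b \<in> C"
    using best_in_alternatives[OF assms(1) order_refl] assms(2) by (auto simp: alternatives_def)
  have rejected: "s i < cutoff I q s (outcome (Suc u)) b"
    if "application u i = Some b" "outcome (Suc u) i \<noteq> Some b" for u
    unfolding outcome_Suc using that[unfolded outcome_Suc]
    by (intro less_cutoff_if_rejected finite_students score_inj capacity_pos b assms(1))
  show ?thesis
    using assms(3,4)
  proof (induction t rule: dec_induct)
    case base
    have "application 0 i = Some b"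
      using assms(2) by (simp add: application_def straightforward_def)
    with base show ?case
      using rejected[of 0] by simp
  next
    case (step u)
    show ?case
    proof (cases "outcome u i = Some b")
      case True
      then show ?thesis
        using held_reapplies rejected step by simp
    next
      case False
      then show ?thesis
        using step cutoff_outcome_mono[OF _ b, of u] by fastforce
    qed
  qed
qed

text \<open>Entering the top-ranked college after round \<open>t\<close> requires choosing it from a
  menu of colleges whose cutoff the student meets. Such a choice shows that it is her favourite
  overall, and then not holding it at \<open>t\<close> means that she is below its cutoff.\<close>

lemma first_choice_antimono:
  assumes "i \<in> I" "t \<ge> 1" "outcome (Suc t) i = Some (ranked_college C (R i) 1)"
  shows "outcome t i = Some (ranked_college C (R i) 1)"
proof (rule ccontr)
  let ?b = "ranked_college C (R i) 1"
  let ?D = "{c \<in> C. s i \<ge> cutoff I q s (outcome t) c}"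
  assume not: "outcome t i \<noteq> Some ?b"
  have "application t i = Some ?b"
    using assms(3) tentative_matching_SomeD unfolding outcome_Suc by metis
  \<comment> \<open>A held student reapplies to her own college, so applying to \<open>?b\<close>
    without holding it means that she was unassigned and chose from \<open>?D\<close>.\<close>
  then have best: "best (R i) (alternatives ?D) = Some ?b"
    using not assms(2) by (auto simp: application_def straightforward_def split: option.splits)
  then have "?b \<in> ?D"
    using best_in_alternatives[OF assms(1), of ?D] by (auto simp: alternatives_def)
  moreover have "best (R i) (alternatives C) = Some ?b"
    using best_alternatives_first_ranked_college[OF finite_colleges profile[OF assms(1)] _ best]
    by auto
  then have "s i < cutoff I q s (outcome t) ?b"
    using less_cutoff_of_first_choice assms not by blast
  ultimately show False by simp
qed

text \<open>Double counting. An individual student may lose her place, so growth of the number of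
  assigned students is visible only college by college.\<close>

lemma number_assigned_eq:
  "(\<Sum>i\<in>I. of_bool (outcome t i \<noteq> None) :: real) = (\<Sum>c\<in>C. real (card (assigned I (outcome t) c)))"
proof -
  have "(\<Sum>i\<in>I. of_bool (outcome t i \<noteq> None) :: real)
      = (\<Sum>i\<in>I. \<Sum>c\<in>C. of_bool (outcome t i = Some c))"
    unfolding sum_of_bool_eq_option[OF finite_colleges]
    using outcome_in_alternatives by (intro sum.cong refl) (auto simp: alternatives_def)
  also have "\<dots> = (\<Sum>c\<in>C. \<Sum>i\<in>I. of_bool (outcome t i = Some c))"
    by (rule sum.swap)
  also have "\<dots> = (\<Sum>c\<in>C. real (card (assigned I (outcome t) c)))"
    using finite_students by (simp add: assigned_def Collect_conj_eq sum_of_bool_eq)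
  finally show ?thesis .
qed

lemma number_non_first_eq:
  assumes "C \<noteq> {}"
  shows "(\<Sum>i\<in>I. \<Sum>l=2..card C. of_bool (outcome t i = Some (ranked_college C (R i) l)) :: real)
    = (\<Sum>i\<in>I. of_bool (outcome t i \<noteq> None))
      - (\<Sum>i\<in>I. of_bool (outcome t i = Some (ranked_college C (R i) 1)))"
proof -
  have "(\<Sum>l=2..card C. of_bool (outcome t i = Some (ranked_college C (R i) l)) :: real)
      = of_bool (outcome t i \<noteq> None) - of_bool (outcome t i = Some (ranked_college C (R i) 1))"
    if i: "i \<in> I" for i
  proof -
    \<comment> \<open>This puts rank 1 inside the range \<open>1..card C\<close>, so that its term
      can be split off from the sum over all ranks.\<close>
    have "1 \<le> card C"
      using assms finite_colleges by (simp add: card_gt_0_iff Suc_le_eq)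
    then show ?thesis
      using sum_of_bool_ranked_college[OF finite_colleges profile[OF i] outcome_in_alternatives[OF i], of t]
      by (simp add: sum.atLeast_Suc_atMost numeral_2_eq_2 del: sum_of_bool_eq)
  qed
  then show ?thesis
    by (simp add: sum_subtractf)
qed

lemma number_non_first_mono:
  assumes "t \<ge> 1"
  shows "(\<Sum>i\<in>I. \<Sum>l=2..card C. of_bool (outcome t i = Some (ranked_college C (R i) l)) :: real)
    \<le> (\<Sum>i\<in>I. \<Sum>l=2..card C. of_bool (outcome (Suc t) i = Some (ranked_college C (R i) l)))"
proof (cases "C = {}")
  case False
  have "(\<Sum>i\<in>I. of_bool (outcome t i \<noteq> None) :: real) \<le> (\<Sum>i\<in>I. of_bool (outcome (Suc t) i \<noteq> None))"
    unfolding number_assigned_eq using card_assigned_outcome_mono[OF assms]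
    by (intro sum_mono) simp
  moreover have "(\<Sum>i\<in>I. of_bool (outcome (Suc t) i = Some (ranked_college C (R i) 1)) :: real)
      \<le> (\<Sum>i\<in>I. of_bool (outcome t i = Some (ranked_college C (R i) 1)))"
    using first_choice_antimono assms by (intro sum_mono) auto
  ultimately show ?thesis
    unfolding number_non_first_eq[OF False] by linarith
qed simp

end

section \<open>From fixed profiles to a random profile\<close>

theorem proposition4:
  fixes I :: "'i set" and C :: "'c set"
    and q :: "'c \<Rightarrow> nat" and s :: "'i \<Rightarrow> real"
    and P :: "('i, 'c) profile pmf" and T :: nat
  assumes "finite I" and "finite C"
    and "\<forall>c\<in>C. q c > 0"
    and "\<forall>i\<in>I. s i > 0" and "inj_on s I"
    and "set_pmf P \<subseteq> preference_profiles I C"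
    and "T \<ge> 1"
  shows "(\<forall>i\<in>I. assignment_prob I C q s P T i 1 \<ge> assignment_prob I C q s P (T + 1) i 1)
    \<and> (\<Sum>i\<in>I. \<Sum>l=2..card C. assignment_prob I C q s P T i l)
        \<le> (\<Sum>i\<in>I. \<Sum>l=2..card C. assignment_prob I C q s P (T + 1) i l)"
proof -
  have play: "straightforward_play I C q s R" if "R \<in> set_pmf P" for R
    using assms that by unfold_locales (auto simp: preference_profiles_def PiE_iff)
  have "assignment_prob I C q s P (Suc T) i 1 \<le> assignment_prob I C q s P T i 1"
    if "i \<in> I" for i
    unfolding assignment_prob_def
    using straightforward_play.first_choice_antimono[OF play that assms(7)]
    \<comment> \<open>The event inclusion is established only for profiles in the support of
      \<open>P\<close>, hence the almost-everywhere form of monotonicity.\<close>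
    by (intro measure_pmf.finite_measure_mono_AE) (auto simp: AE_measure_pmf_iff)
  moreover have "(\<Sum>i\<in>I. \<Sum>l=2..card C. assignment_prob I C q s P T i l)
      \<le> (\<Sum>i\<in>I. \<Sum>l=2..card C. assignment_prob I C q s P (Suc T) i l)"
    \<comment> \<open>Merging students and ranks into one index of pairs is essential: the
      comparison holds only for the total over all students, not for each student
      separately.\<close>
    unfolding assignment_prob_def sum.cartesian_product
    using sum_prob_mono[of "I \<times> {2..card C}" "I \<times> {2..card C}" P
        "\<lambda>(i, l) R. tcdm_outcome I C q s T R i = Some (ranked_college C (R i) l)"
        "\<lambda>(i, l) R. tcdm_outcome I C q s (Suc T) R i = Some (ranked_college C (R i) l)"]
      straightforward_play.number_non_first_mono[OF play assms(7)] assms(1)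
    by (simp add: sum.cartesian_product case_prod_unfold del: sum_of_bool_eq)
  ultimately show ?thesis by simp
qed

end
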